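(* Let $(\mathscr{G},\circ)$ be a dynamical group over $\Lambda$, $(\mathscr{H},\cdot)$ a constant dynamical group over $\Lambda$, $\{\Phi_\lambda:G\to\mathrm{Bij}(H)\}_{\lambda\in\Lambda}$ an action of $\mathscr{G}$ on $\mathscr{H}$, and $\mathcal{B}:H\to G$ a relative Rota-Baxter operator on $\mathscr{G}$ with respect to this action. For $\lambda\in\Lambda$, $a\in G$, $x\in H$ define $$a\rightharpoonup_\lambda x=\Phi_\lambda(a)(x),\qquad a\leftharpoonup_\lambda x=\overline{\mathcal{B}(\Phi_\lambda(a)(x))}^{\lambda}\circ_{\phi_G(\lambda,\mathcal{B}(\Phi_\lambda(a)(x)))}\big(a\circ_\lambda\mathcal{B}(x)\big).$$ Let $\mathscr{H}_{\mathcal{B}}$ be the descendant dynamical group of $\mathcal{B}$. Then $(\mathscr{G},\mathscr{H}_{\mathcal{B}},\sigma)$ is a matched pair of dynamical groups, where $\sigma(\lambda,a,x)=(a\rightharpoonup_\lambda x,\ a\leftharpoonup_\lambda x)$.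
   Context: Fix a non-empty set $\Lambda$. A dynamical set is a triple $\mathscr{X}=(X,\Lambda,\phi_X)$ with $X$ a set and $\phi_X:\Lambda\times X\to\Lambda$ a map. A morphism $\mathscr{X}\to\mathscr{Y}$ is a map $f:\Lambda\times X\to Y$ with $\phi_Y(\lambda,f(\lambda,x))=\phi_X(\lambda,x)$. The tensor product is $\mathscr{X}\otimes\mathscr{Y}=(X\times Y,\Lambda,\phi_{X\times Y})$, $\phi_{X\times Y}(\lambda,x,y)=\phi_Y(\phi_X(\lambda,x),y)$. Dynamical group: a dynamical set $\mathscr{G}=(G,\Lambda,\phi_G)$ with maps $\circ_\lambda:G\times G\to G$ ($\lambda\in\Lambda$) such that $\phi_G(\lambda,a\circ_\lambda b)=\phi_G(\phi_G(\lambda,a),b)$ and $a\circ_\lambda(b\circ_{\phi_G(\lambda,a)}c)=(a\circ_\lambda b)\circ_\lambda c$; an element $e_G\in G$ with $a\circ_\lambda e_G=e_G\circ_\lambda a=a$ and $\phi_G(\lambda,e_G)=\lambda$; and for all $\lambda,a$ a (unique) element $\bar a^\lambda\in G$ with $a\circ_\lambda\bar a^\lambda=\bar a^\lambda\circ_{\phi_G(\lambda,a)}a=e_G$. A constant dynamical group is a dynamical group $(\mathscr{H},\cdot)$ with $\phi_H(\lambda,x)=\lambda$ for all $\lambda,x$ (i.e. a family of group structures $\cdot_\lambda$ on $H$ with common unit $e_H$). Action of a dynamical group $\mathscr{G}$ on a constant dynamical group $\mathscr{H}$: maps $\Phi_\lambda:G\to\mathrm{Bij}(H)$ (bijections of the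 set $H$) with $\Phi_\lambda(a)(x\cdot_{\phi_G(\lambda,a)}y)=(\Phi_\lambda(a)x)\cdot_\lambda(\Phi_\lambda(a)y)$ and $\Phi_\lambda(a\circ_\lambda b)=\Phi_\lambda(a)\Phi_{\phi_G(\lambda,a)}(b)$. Relative Rota-Baxter operator: a map $\mathcal{B}:H\to G$ with $\mathcal{B}(x)\circ_\lambda\mathcal{B}(y)=\mathcal{B}(x\cdot_\lambda\Phi_\lambda(\mathcal{B}(x))(y))$ for all $\lambda,x,y$. Its descendant dynamical group $\mathscr{H}_{\mathcal{B}}$ is the dynamical group on the set $H$ with structure map $\phi_{\mathcal{B}}(\lambda,x)=\phi_G(\lambda,\mathcal{B}(x))$, product $x\circ^{\mathcal{B}}_\lambda y=x\cdot_\lambda\Phi_\lambda(\mathcal{B}(x))(y)$ and unit $e_H$. Matched pair of dynamical groups $(\mathscr{G},\mathscr{K},\sigma)$ for dynamical groups $(\mathscr{G},\circ)$, $(\mathscr{K},\ast)$: a map $\sigma:\Lambda\times G\times K\to K\times G$, $\sigma(\lambda,a,x)=(a\rightharpoonup_\lambda x,\ a\leftharpoonup_\lambda x)$, which is a morphism $\mathscr{G}\otimes\mathscr{K}\to\mathscr{K}\otimes\mathscr{G}$, i.e. $\phi_G(\phi_K(\lambda,a\rightharpoonup_\lambda x),a\leftharpoonup_\lambda x)=\phi_K(\phi_G(\lambda,a),x)$, such that for all $\lambda\in\Lambda$, $a,b\in G$, $x,y\in K$: (1) $e_G\rightharpoonup_\lambda x=x$; (2) $(a\circ_\lambda b)\rightharpoonup_\lambda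 x=a\rightharpoonup_\lambda(b\rightharpoonup_{\phi_G(\lambda,a)}x)$; (3) $a\rightharpoonup_\lambda(x\ast_{\phi_G(\lambda,a)}y)=(a\rightharpoonup_\lambda x)\ast_\lambda\big((a\leftharpoonup_\lambda x)\rightharpoonup_{\phi_K(\lambda,a\rightharpoonup_\lambda x)}y\big)$; (4) $a\leftharpoonup_\lambda e_K=a$; (5) $a\leftharpoonup_\lambda(x\ast_{\phi_G(\lambda,a)}y)=(a\leftharpoonup_\lambda x)\leftharpoonup_{\phi_K(\lambda,a\rightharpoonup_\lambda x)}y$; (6) $(a\circ_\lambda b)\leftharpoonup_\lambda x=\big(a\leftharpoonup_\lambda(b\rightharpoonup_{\phi_G(\lambda,a)}x)\big)\circ_{\phi_K(\lambda,(a\circ_\lambda b)\rightharpoonup_\lambda x)}(b\leftharpoonup_{\phi_G(\lambda,a)}x)$. *)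

theory Defs
  imports "HOL-Algebra.Congruence"
begin

text \<open>
  The parameter set \<open>\<Lambda>\<close> is fixed throughout and is passed as an explicit argument \<open>L\<close>
  instead of being stored in each structure. All conditions are relativised to \<open>L\<close> and to
  the carriers; no values outside of them are prescribed.
\<close>

record ('l, 'x) dyn_set = "'x partial_object" +
  phi :: "'l \<Rightarrow> 'x \<Rightarrow> 'l"

locale dynamical_set =
  fixes L :: "'l set" and X :: "('l, 'x, 'm) dyn_set_scheme"
  assumes phi_closed: "\<lbrakk>l \<in> L; x \<in> carrier X\<rbrakk> \<Longrightarrow> phi X l x \<in> L"

definition dyn_tensor ::
  "('l, 'x, 'm) dyn_set_scheme \<Rightarrow> ('l, 'y, 'n) dyn_set_scheme \<Rightarrow> ('l, 'x \<times> 'y) dyn_set"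
where
  "dyn_tensor X Y =
     \<lparr>carrier = carrier X \<times> carrier Y, phi = (\<lambda>l (x, y). phi Y (phi X l x) y)\<rparr>"

definition dyn_morphism ::
  "'l set \<Rightarrow> ('l, 'x, 'm) dyn_set_scheme \<Rightarrow> ('l, 'y, 'n) dyn_set_scheme \<Rightarrow> ('l \<Rightarrow> 'x \<Rightarrow> 'y) \<Rightarrow> bool"
where
  "dyn_morphism L X Y f \<longleftrightarrow>
     (\<forall>l\<in>L. \<forall>x\<in>carrier X. f l x \<in> carrier Y \<and> phi Y l (f l x) = phi X l x)"

record ('l, 'x) dyn_group = "('l, 'x) dyn_set" +
  dmul :: "'l \<Rightarrow> 'x \<Rightarrow> 'x \<Rightarrow> 'x"
  dunit :: 'x

text \<open>The inverse of \<open>a\<close> depends on the parameter: it is taken with respect to \<open>l\<close>.\<close>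

definition is_dinv :: "('l, 'x, 'm) dyn_group_scheme \<Rightarrow> 'l \<Rightarrow> 'x \<Rightarrow> 'x \<Rightarrow> bool" where
  "is_dinv G l a b \<longleftrightarrow>
     b \<in> carrier G \<and> dmul G l a b = dunit G \<and> dmul G (phi G l a) b a = dunit G"

definition dinv :: "('l, 'x, 'm) dyn_group_scheme \<Rightarrow> 'l \<Rightarrow> 'x \<Rightarrow> 'x" where
  "dinv G l a = (THE b. is_dinv G l a b)"

locale dynamical_group = dynamical_set L G
  for L :: "'l set" and G :: "('l, 'x, 'm) dyn_group_scheme" +
  assumes dmul_closed:
      "\<lbrakk>l \<in> L; a \<in> carrier G; b \<in> carrier G\<rbrakk> \<Longrightarrow> dmul G l a b \<in> carrier G"
    and phi_dmul:
      "\<lbrakk>l \<in> L; a \<in> carrier G; b \<in> carrier G\<rbrakk> \<Longrightarrow> phi G l (dmul G l a b) = phi G (phi G l a) b"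
    and dmul_assoc:
      "\<lbrakk>l \<in> L; a \<in> carrier G; b \<in> carrier G; c \<in> carrier G\<rbrakk> \<Longrightarrow>
         dmul G l a (dmul G (phi G l a) b c) = dmul G l (dmul G l a b) c"
    and dunit_closed: "dunit G \<in> carrier G"
    and dmul_dunit_right: "\<lbrakk>l \<in> L; a \<in> carrier G\<rbrakk> \<Longrightarrow> dmul G l a (dunit G) = a"
    and dmul_dunit_left: "\<lbrakk>l \<in> L; a \<in> carrier G\<rbrakk> \<Longrightarrow> dmul G l (dunit G) a = a"
    and phi_dunit: "l \<in> L \<Longrightarrow> phi G l (dunit G) = l"
    and dinv_ex1: "\<lbrakk>l \<in> L; a \<in> carrier G\<rbrakk> \<Longrightarrow> \<exists>!b. is_dinv G l a b"

locale constant_dynamical_group = dynamical_group L H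
  for L :: "'l set" and H :: "('l, 'x, 'm) dyn_group_scheme" +
  assumes phi_const: "\<lbrakk>l \<in> L; x \<in> carrier H\<rbrakk> \<Longrightarrow> phi H l x = l"

locale dyn_group_action = G: dynamical_group L G + H: constant_dynamical_group L H
  for L :: "'l set"
    and G :: "('l, 'g, 'm) dyn_group_scheme"
    and H :: "('l, 'h, 'n) dyn_group_scheme" +
  fixes \<Phi> :: "'l \<Rightarrow> 'g \<Rightarrow> 'h \<Rightarrow> 'h"
  assumes act_bij:
      "\<lbrakk>l \<in> L; a \<in> carrier G\<rbrakk> \<Longrightarrow> bij_betw (\<Phi> l a) (carrier H) (carrier H)"
    and act_dmul_right:
      "\<lbrakk>l \<in> L; a \<in> carrier G; x \<in> carrier H; y \<in> carrier H\<rbrakk> \<Longrightarrow>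
         \<Phi> l a (dmul H (phi G l a) x y) = dmul H l (\<Phi> l a x) (\<Phi> l a y)"
    and act_dmul_left:
      "\<lbrakk>l \<in> L; a \<in> carrier G; b \<in> carrier G; x \<in> carrier H\<rbrakk> \<Longrightarrow>
         \<Phi> l (dmul G l a b) x = \<Phi> l a (\<Phi> (phi G l a) b x)"

locale relative_rota_baxter = dyn_group_action L G H \<Phi>
  for L :: "'l set"
    and G :: "('l, 'g, 'm) dyn_group_scheme"
    and H :: "('l, 'h, 'n) dyn_group_scheme"
    and \<Phi> :: "'l \<Rightarrow> 'g \<Rightarrow> 'h \<Rightarrow> 'h" +
  fixes B :: "'h \<Rightarrow> 'g"
  assumes rb_closed: "x \<in> carrier H \<Longrightarrow> B x \<in> carrier G"
    and rb_dmul: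
      "\<lbrakk>l \<in> L; x \<in> carrier H; y \<in> carrier H\<rbrakk> \<Longrightarrow>
         dmul G l (B x) (B y) = B (dmul H l x (\<Phi> l (B x) y))"

definition descendant ::
  "('l, 'g, 'm) dyn_group_scheme \<Rightarrow> ('l, 'h, 'n) dyn_group_scheme \<Rightarrow>
    ('l \<Rightarrow> 'g \<Rightarrow> 'h \<Rightarrow> 'h) \<Rightarrow> ('h \<Rightarrow> 'g) \<Rightarrow> ('l, 'h) dyn_group"
where
  "descendant G H \<Phi> B =
     \<lparr>carrier = carrier H,
      phi = (\<lambda>l x. phi G l (B x)),
      dmul = (\<lambda>l x y. dmul H l x (\<Phi> l (B x) y)),
      dunit = dunit H\<rparr>"

locale matched_pair = G: dynamical_group L G + K: dynamical_group L K
  for L :: "'l set"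
    and G :: "('l, 'g, 'm) dyn_group_scheme"
    and K :: "('l, 'k, 'n) dyn_group_scheme" +
  fixes \<sigma> :: "'l \<Rightarrow> 'g \<times> 'k \<Rightarrow> 'k \<times> 'g"
    and lact :: "'l \<Rightarrow> 'g \<Rightarrow> 'k \<Rightarrow> 'k"
    and ract :: "'l \<Rightarrow> 'g \<Rightarrow> 'k \<Rightarrow> 'g"
  defines "lact \<equiv> \<lambda>l a x. fst (\<sigma> l (a, x))"
    and "ract \<equiv> \<lambda>l a x. snd (\<sigma> l (a, x))"
  assumes sigma_morphism: "dyn_morphism L (dyn_tensor G K) (dyn_tensor K G) \<sigma>"
    and lact_dunit: "\<lbrakk>l \<in> L; x \<in> carrier K\<rbrakk> \<Longrightarrow> lact l (dunit G) x = x"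
    and lact_dmul_left:
      "\<lbrakk>l \<in> L; a \<in> carrier G; b \<in> carrier G; x \<in> carrier K\<rbrakk> \<Longrightarrow>
         lact l (dmul G l a b) x = lact l a (lact (phi G l a) b x)"
    and lact_dmul_right:
      "\<lbrakk>l \<in> L; a \<in> carrier G; x \<in> carrier K; y \<in> carrier K\<rbrakk> \<Longrightarrow>
         lact l a (dmul K (phi G l a) x y) =
           dmul K l (lact l a x) (lact (phi K l (lact l a x)) (ract l a x) y)"
    and ract_dunit: "\<lbrakk>l \<in> L; a \<in> carrier G\<rbrakk> \<Longrightarrow> ract l a (dunit K) = a"
    and ract_dmul_right:
      "\<lbrakk>l \<in> L; a \<in> carrier G; x \<in> carrier K; y \<in> carrier K\<rbrakk> \<Longrightarrow>
         ract l a (dmul K (phi G l a) x y) = ract (phi K l (lact l a x)) (ract l a x) y"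
    and ract_dmul_left:
      "\<lbrakk>l \<in> L; a \<in> carrier G; b \<in> carrier G; x \<in> carrier K\<rbrakk> \<Longrightarrow>
         ract l (dmul G l a b) x =
           dmul G (phi K l (lact l (dmul G l a b) x))
             (ract l a (lact (phi G l a) b x)) (ract (phi G l a) b x)"

end

(* Everything follows from the factorisation B(a \<rightharpoonup> x) \<circ> (a \<leftharpoonup> x) = a \<circ> B x, which by left cancellation
   determines a \<leftharpoonup> x: each axiom about \<leftharpoonup> is checked after multiplying it on the left by the
   matching value of B. *)
theory Submission
  imports Defs
begin

section \<open>Inverses and cancellation in a dynamical group\<close>

context dynamical_group
begin

lemma is_dinv_dinv: "\<lbrakk>l \<in> L; a \<in> carrier G\<rbrakk> \<Longrightarrow> is_dinv G l a (dinv G l a)"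
  unfolding dinv_def by (rule theI') (rule dinv_ex1)

lemma dinv_closed: "\<lbrakk>l \<in> L; a \<in> carrier G\<rbrakk> \<Longrightarrow> dinv G l a \<in> carrier G"
  and dmul_dinv_right: "\<lbrakk>l \<in> L; a \<in> carrier G\<rbrakk> \<Longrightarrow> dmul G l a (dinv G l a) = dunit G"
  and dmul_dinv_left:
    "\<lbrakk>l \<in> L; a \<in> carrier G\<rbrakk> \<Longrightarrow> dmul G (phi G l a) (dinv G l a) a = dunit G"
  using is_dinv_dinv unfolding is_dinv_def by blast+

text \<open>Multiplicativity of \<open>phi\<close> turns \<open>a\<close> times its inverse into a
  round trip from \<open>l\<close> to \<open>l\<close>. This aligns the parameters when
  associativity is applied in \<open>dinv_dmul_cancel\<close>.\<close>

lemma phi_dinv: "\<lbrakk>l \<in> L; a \<in> carrier G\<rbrakk> \<Longrightarrow> phi G (phi G l a) (dinv G l a) = l"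
  by (metis dinv_closed dmul_dinv_right phi_dmul phi_dunit)

lemma dinv_dmul_cancel:
  assumes "l \<in> L" "a \<in> carrier G" "b \<in> carrier G"
  shows "dmul G (phi G l a) (dinv G l a) (dmul G l a b) = b"
  using dmul_assoc[of "phi G l a" "dinv G l a" a b] assms
  by (simp add: phi_closed dinv_closed phi_dinv dmul_dinv_left dmul_dunit_left)

lemma dmul_dinv_cancel:
  assumes "l \<in> L" "a \<in> carrier G" "b \<in> carrier G"
  shows "dmul G l a (dmul G (phi G l a) (dinv G l a) b) = b"
  using assms by (simp add: dmul_assoc dinv_closed dmul_dinv_right dmul_dunit_left)

lemma dmul_left_cancel:
  assumes "l \<in> L" "a \<in> carrier G" "b \<in> carrier G" "c \<in> carrier G"
    and "dmul G l a b = dmul G l a c"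
  shows "b = c"
  using dinv_dmul_cancel assms by metis

text \<open>Cancel \<open>a\<close> on the left from \<open>a a = a e\<close>. Both the action and
  \<open>B\<close> are shown to preserve units this way.\<close>

lemma dmul_idem_imp_dunit:
  assumes "l \<in> L" "a \<in> carrier G" "dmul G l a a = a"
  shows "a = dunit G"
  using dmul_left_cancel[of l a a "dunit G"] assms by (simp add: dunit_closed dmul_dunit_right)

end

section \<open>Units and closure for actions on constant dynamical groups\<close>

lemma (in constant_dynamical_group) const_dmul_assoc:
  assumes "l \<in> L" "x \<in> carrier H" "y \<in> carrier H" "z \<in> carrier H"
  shows "dmul H l x (dmul H l y z) = dmul H l (dmul H l x y) z"
  using dmul_assoc[of l x y z] assms by (simp add: phi_const)

context dyn_group_action
begin

lemma act_closed: "\<lbrakk>l \<in> L; a \<in> carrier G; x \<in> carrier H\<rbrakk> \<Longrightarrow> \<Phi> l a x \<in> carrier H"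
  using act_bij bij_betwE by blast

text \<open>The unit of \<open>H\<close> is idempotent at the parameter \<open>phi G l a\<close>, so
  its image is idempotent at \<open>l\<close>.\<close>

lemma act_dunit_right: "\<lbrakk>l \<in> L; a \<in> carrier G\<rbrakk> \<Longrightarrow> \<Phi> l a (dunit H) = dunit H"
  by (metis H.dmul_dunit_left H.dmul_idem_imp_dunit H.dunit_closed G.phi_closed
      act_closed act_dmul_right)

text \<open>Since \<open>dunit G\<close> does not move \<open>l\<close>, the map
  \<open>\<Phi> l (dunit G)\<close> equals its own square; being injective, it is the
  identity.\<close>

lemma act_dunit_left:
  assumes "l \<in> L" "x \<in> carrier H"
  shows "\<Phi> l (dunit G) x = x"
proof -
  have "\<Phi> l (dunit G) (\<Phi> l (dunit G) x) = \<Phi> l (dunit G) x"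
    using act_dmul_left[of l "dunit G" "dunit G" x] assms
    by (simp add: G.dunit_closed G.dmul_dunit_left G.phi_dunit)
  then show ?thesis
    using act_bij[of l "dunit G"] assms G.dunit_closed act_closed
    by (metis bij_betw_imp_inj_on inj_onD)
qed

end

section \<open>The descendant dynamical group\<close>

context relative_rota_baxter
begin

text \<open>The operator identity at the unit makes \<open>B (dunit H)\<close> idempotent; the
  hypothesis supplies a parameter at which to multiply.\<close>

lemma rb_dunit: "B (dunit H) = dunit G" if "l \<in> L"
  using rb_dmul[of l "dunit H" "dunit H"] that
    G.dmul_idem_imp_dunit[of l "B (dunit H)"]
  by (simp add: H.dunit_closed rb_closed act_dunit_right H.dmul_dunit_left)

definition desc_dmul :: "'l \<Rightarrow> 'h \<Rightarrow> 'h \<Rightarrow> 'h" where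
  "desc_dmul l x y = dmul H l x (\<Phi> l (B x) y)"

lemma desc_dmul_closed:
  "\<lbrakk>l \<in> L; x \<in> carrier H; y \<in> carrier H\<rbrakk> \<Longrightarrow> desc_dmul l x y \<in> carrier H"
  by (simp add: desc_dmul_def H.dmul_closed act_closed rb_closed)

lemma rb_desc_dmul:
  "\<lbrakk>l \<in> L; x \<in> carrier H; y \<in> carrier H\<rbrakk> \<Longrightarrow> B (desc_dmul l x y) = dmul G l (B x) (B y)"
  by (simp add: desc_dmul_def rb_dmul)

text \<open>After distributing over the product of \<open>H\<close>, the two nested actions on
  \<open>y\<close> merge into one. Taking \<open>a = B x\<close> yields associativity of
  \<open>desc_dmul\<close>.\<close>

lemma act_desc_dmul:
  assumes "l \<in> L" "a \<in> carrier G" "x \<in> carrier H" "y \<in> carrier H"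
  shows "\<Phi> l a (desc_dmul (phi G l a) x y) =
    dmul H l (\<Phi> l a x) (\<Phi> l (dmul G l a (B x)) y)"
  using assms
  by (simp add: desc_dmul_def act_dmul_right act_dmul_left rb_closed act_closed G.phi_closed)

text \<open>Both bracketings are the product in \<open>H\<close> of \<open>x\<close>,
  \<open>\<Phi> l (B x) y\<close> and the action of \<open>B x\<close> times \<open>B y\<close> on
  \<open>z\<close>, because \<open>B\<close> is multiplicative for \<open>desc_dmul\<close>.\<close>

lemma desc_dmul_assoc:
  assumes "l \<in> L" "x \<in> carrier H" "y \<in> carrier H" "z \<in> carrier H"
  shows "desc_dmul l x (desc_dmul (phi G l (B x)) y z) = desc_dmul l (desc_dmul l x y) z"
proof -
  have "desc_dmul l x (desc_dmul (phi G l (B x)) y z) =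
      dmul H l x (dmul H l (\<Phi> l (B x) y) (\<Phi> l (dmul G l (B x) (B y)) z))"
    using assms by (simp add: desc_dmul_def[of l x] act_desc_dmul rb_closed)
  also have "\<dots> = dmul H l (desc_dmul l x y) (\<Phi> l (B (desc_dmul l x y)) z)"
    using assms
    by (simp add: rb_dmul H.const_dmul_assoc act_closed rb_closed H.dmul_closed
        desc_dmul_def[of l x y])
  finally show ?thesis by (simp add: desc_dmul_def)
qed

lemma desc_dmul_dunit_right:
  "\<lbrakk>l \<in> L; x \<in> carrier H\<rbrakk> \<Longrightarrow> desc_dmul l x (dunit H) = x"
  by (simp add: desc_dmul_def act_dunit_right rb_closed H.dmul_dunit_right)

lemma desc_dmul_dunit_left:
  "\<lbrakk>l \<in> L; x \<in> carrier H\<rbrakk> \<Longrightarrow> desc_dmul l (dunit H) x = x"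
  by (simp add: desc_dmul_def rb_dunit act_dunit_left H.dmul_dunit_left)

text \<open>Surjectivity of \<open>\<Phi> l (B x)\<close> allows solving for the \<open>y\<close>
  that it sends to the inverse of \<open>x\<close> in \<open>H\<close>.\<close>

lemma desc_right_inverse:
  assumes "l \<in> L" "x \<in> carrier H"
  obtains y where "y \<in> carrier H" "desc_dmul l x y = dunit H"
proof -
  have "dinv H l x \<in> \<Phi> l (B x) ` carrier H"
    using assms act_bij[of l "B x"] by (simp add: rb_closed H.dinv_closed bij_betw_def)
  then obtain y where "y \<in> carrier H" "\<Phi> l (B x) y = dinv H l x"
    by auto
  then show thesis
    using assms that[of y] by (simp add: desc_dmul_def H.dmul_dinv_right)
qed

text \<open>As in a monoid with right inverses: \<open>y\<close> has a right inverse
  \<open>z\<close> at the shifted parameter, and \<open>x = x (y z) = (x y) z = z\<close>.\<close>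

lemma desc_right_inverse_is_left_inverse:
  assumes l: "l \<in> L" and x: "x \<in> carrier H" and y: "y \<in> carrier H"
    and xy: "desc_dmul l x y = dunit H"
  shows "desc_dmul (phi G l (B x)) y x = dunit H"
proof -
  have m: "phi G l (B x) \<in> L"
    using l x by (simp add: G.phi_closed rb_closed)
  obtain z where z: "z \<in> carrier H" "desc_dmul (phi G l (B x)) y z = dunit H"
    using desc_right_inverse[OF m y] .
  have "x = z"
    using desc_dmul_assoc[OF l x y z(1)] xy z l x
    by (simp add: desc_dmul_dunit_left desc_dmul_dunit_right)
  then show ?thesis using z by simp
qed

lemma desc_dmul_left_cancel:
  assumes l: "l \<in> L" and x: "x \<in> carrier H" and "y \<in> carrier H" "z \<in> carrier H"
    and eq: "desc_dmul l x y = desc_dmul l x z"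
  shows "y = z"
proof -
  have "\<Phi> l (B x) y = \<Phi> l (B x) z"
    using eq assms H.dmul_left_cancel[of l x "\<Phi> l (B x) y" "\<Phi> l (B x) z"]
    by (simp add: desc_dmul_def act_closed rb_closed)
  then show ?thesis
    using act_bij[of l "B x"] assms rb_closed by (metis bij_betw_imp_inj_on inj_onD)
qed

lemma descendant_simps:
  "carrier (descendant G H \<Phi> B) = carrier H"
  "phi (descendant G H \<Phi> B) l x = phi G l (B x)"
  "dmul (descendant G H \<Phi> B) l x y = desc_dmul l x y"
  "dunit (descendant G H \<Phi> B) = dunit H"
  by (simp_all add: descendant_def desc_dmul_def)

theorem descendant_dynamical_group: "dynamical_group L (descendant G H \<Phi> B)"
proof (unfold_locales, unfold descendant_simps)
  fix l x assume l: "l \<in> L" and x: "x \<in> carrier H"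
  obtain y where y: "y \<in> carrier H" "desc_dmul l x y = dunit H"
    using desc_right_inverse[OF l x] .
  show "\<exists>!y. is_dinv (descendant G H \<Phi> B) l x y"
    unfolding is_dinv_def descendant_simps
    \<comment> \<open>Uniqueness comes from left cancellation between two right inverses.\<close>
    using y desc_right_inverse_is_left_inverse[OF l x y] desc_dmul_left_cancel[OF l x]
    by (intro ex1I[of _ y]) auto
qed (simp_all add: desc_dmul_closed desc_dmul_assoc desc_dmul_dunit_right desc_dmul_dunit_left
    rb_desc_dmul rb_dunit rb_closed G.phi_closed G.phi_dmul G.phi_dunit H.dunit_closed)

section \<open>The right action and the matched pair axioms\<close>

definition rb_ract :: "'l \<Rightarrow> 'g \<Rightarrow> 'h \<Rightarrow> 'g" where
  "rb_ract l a x =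
     dmul G (phi G l (B (\<Phi> l a x))) (dinv G l (B (\<Phi> l a x))) (dmul G l a (B x))"

lemma rb_ract_closed:
  "\<lbrakk>l \<in> L; a \<in> carrier G; x \<in> carrier H\<rbrakk> \<Longrightarrow> rb_ract l a x \<in> carrier G"
  by (simp add: rb_ract_def G.dmul_closed G.dinv_closed G.phi_closed act_closed rb_closed)

lemma rb_factorisation:
  "\<lbrakk>l \<in> L; a \<in> carrier G; x \<in> carrier H\<rbrakk> \<Longrightarrow>
    dmul G l (B (\<Phi> l a x)) (rb_ract l a x) = dmul G l a (B x)"
  by (simp add: rb_ract_def G.dmul_dinv_cancel act_closed rb_closed G.dmul_closed)

lemma rb_ract_unique:
  assumes "l \<in> L" "a \<in> carrier G" "x \<in> carrier H" "c \<in> carrier G"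
    and "dmul G l (B (\<Phi> l a x)) c = dmul G l a (B x)"
  shows "rb_ract l a x = c"
  using assms G.dmul_left_cancel[of l "B (\<Phi> l a x)"]
  by (simp add: rb_factorisation rb_ract_closed act_closed rb_closed)

text \<open>Apply \<open>phi G l\<close> to both sides of the factorisation. This is the morphism
  condition on \<sigma>.\<close>

lemma phi_rb_ract:
  assumes "l \<in> L" "a \<in> carrier G" "x \<in> carrier H"
  shows "phi G (phi G l (B (\<Phi> l a x))) (rb_ract l a x) = phi G (phi G l a) (B x)"
  using assms rb_factorisation[of l a x]
  by (metis G.phi_dmul act_closed rb_closed rb_ract_closed)

text \<open>In \<open>act_desc_dmul\<close> the element acting on \<open>y\<close> is
  \<open>a\<close> times \<open>B x\<close>; the factorisation rewrites it, and the action law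
  splits it again.\<close>

lemma act_desc_dmul_rb_ract:
  assumes "l \<in> L" "a \<in> carrier G" "x \<in> carrier H" "y \<in> carrier H"
  shows "\<Phi> l a (desc_dmul (phi G l a) x y) =
    desc_dmul l (\<Phi> l a x) (\<Phi> (phi G l (B (\<Phi> l a x))) (rb_ract l a x) y)"
  using assms
  by (simp add: act_desc_dmul desc_dmul_def[of l] act_dmul_left[symmetric] rb_factorisation
      act_closed rb_closed rb_ract_closed)

lemma rb_ract_dunit: "\<lbrakk>l \<in> L; a \<in> carrier G\<rbrakk> \<Longrightarrow> rb_ract l a (dunit H) = a"
  by (rule rb_ract_unique)
    (simp_all add: H.dunit_closed act_dunit_right rb_dunit G.dmul_dunit_left G.dmul_dunit_right)

lemma rb_ract_desc_dmul:
  assumes l: "l \<in> L" and a: "a \<in> carrier G" and x: "x \<in> carrier H" and y: "y \<in> carrier H"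
  shows "rb_ract l a (desc_dmul (phi G l a) x y) =
    rb_ract (phi G l (B (\<Phi> l a x))) (rb_ract l a x) y"
proof -
  define m where "m = phi G l (B (\<Phi> l a x))"
  define c where "c = rb_ract l a x"
  have m: "m \<in> L" and c: "c \<in> carrier G"
    using l a x by (simp_all add: m_def c_def G.phi_closed act_closed rb_closed rb_ract_closed)
  have u: "B (\<Phi> l a x) \<in> carrier G" and v: "\<Phi> m c y \<in> carrier H"
    using l a x y m c by (simp_all add: act_closed rb_closed)
  have la: "phi G l a \<in> L" using l a by (simp add: G.phi_closed)
  \<comment> \<open>Here \<open>B\<close> splits the left factor; the factorisation is then used
    first for \<open>c\<close> and \<open>y\<close> at \<open>m\<close>, next for \<open>a\<close>
    and \<open>x\<close> at \<open>l\<close>.\<close>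
  have "dmul G l (B (\<Phi> l a (desc_dmul (phi G l a) x y))) (rb_ract m c y) =
      dmul G l (dmul G l (B (\<Phi> l a x)) (B (\<Phi> m c y))) (rb_ract m c y)"
    using l a x y v
    by (simp add: act_desc_dmul_rb_ract rb_desc_dmul act_closed m_def c_def)
  also have "\<dots> = dmul G l (B (\<Phi> l a x)) (dmul G m (B (\<Phi> m c y)) (rb_ract m c y))"
    using l u v m c y by (simp add: m_def G.dmul_assoc rb_closed rb_ract_closed)
  also have "\<dots> = dmul G l (dmul G l (B (\<Phi> l a x)) c) (B y)"
    using l u m c y by (simp add: rb_factorisation G.dmul_assoc rb_closed m_def)
  also have "\<dots> = dmul G l (dmul G l a (B x)) (B y)"
    using l a x by (simp add: c_def rb_factorisation)
  also have "\<dots> = dmul G l a (B (desc_dmul (phi G l a) x y))"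
    using l a x y la by (simp add: rb_desc_dmul G.dmul_assoc rb_closed)
  finally show ?thesis
    using l a x y m c la
    by (intro rb_ract_unique) (simp_all add: desc_dmul_closed rb_ract_closed m_def c_def)
qed

lemma rb_ract_dmul:
  assumes l: "l \<in> L" and a: "a \<in> carrier G" and b: "b \<in> carrier G" and x: "x \<in> carrier H"
  shows "rb_ract l (dmul G l a b) x =
    dmul G (phi G l (B (\<Phi> l (dmul G l a b) x)))
      (rb_ract l a (\<Phi> (phi G l a) b x)) (rb_ract (phi G l a) b x)"
proof -
  define k where "k = phi G l a"
  define y where "y = \<Phi> k b x"
  define m where "m = phi G l (B (\<Phi> l a y))"
  have k: "k \<in> L" using l a by (simp add: k_def G.phi_closed)
  have y: "y \<in> carrier H" using k b x by (simp add: y_def act_closed)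
  \<comment> \<open>Hence both sides involve the same value of \<open>B\<close>, and
    \<open>m\<close> is the parameter of the outer product in the claim.\<close>
  have aby: "\<Phi> l (dmul G l a b) x = \<Phi> l a y"
    using l a b x by (simp add: act_dmul_left y_def k_def)
  have u: "B (\<Phi> l a y) \<in> carrier G" using l a y by (simp add: act_closed rb_closed)
  have m: "m \<in> L" using l u by (simp add: m_def G.phi_closed)
  have r: "rb_ract l a y \<in> carrier G" and s: "rb_ract k b x \<in> carrier G"
    using l a y k b x by (simp_all add: rb_ract_closed)
  \<comment> \<open>The factorisation is used twice: \<open>a\<close> passes \<open>B y\<close> at
    \<open>l\<close>, then \<open>b\<close> passes \<open>B x\<close> at \<open>k\<close>.\<close>
  have "dmul G l (B (\<Phi> l a y)) (dmul G m (rb_ract l a y) (rb_ract k b x)) =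
      dmul G l (dmul G l a (B y)) (rb_ract k b x)"
    using l a y u r s by (simp add: m_def G.dmul_assoc rb_factorisation)
  also have "\<dots> = dmul G l a (dmul G k (B y) (rb_ract k b x))"
    using l a y s by (simp add: k_def G.dmul_assoc rb_closed)
  also have "\<dots> = dmul G l (dmul G l a b) (B x)"
    using l a b x k by (simp add: y_def rb_factorisation) (simp add: k_def G.dmul_assoc rb_closed)
  finally have "rb_ract l (dmul G l a b) x = dmul G m (rb_ract l a y) (rb_ract k b x)"
    using l a b x m r s by (intro rb_ract_unique) (simp_all add: aby G.dmul_closed)
  then show ?thesis by (simp add: aby m_def y_def k_def)
qed

end

theorem proposition3p8:
  fixes L :: "'l set"
    and G :: "('l, 'g) dyn_group"
    and H :: "('l, 'h) dyn_group"
    and \<Phi> :: "'l \<Rightarrow> 'g \<Rightarrow> 'h \<Rightarrow> 'h"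
    and B :: "'h \<Rightarrow> 'g"
    and lact :: "'l \<Rightarrow> 'g \<Rightarrow> 'h \<Rightarrow> 'h"
    and ract :: "'l \<Rightarrow> 'g \<Rightarrow> 'h \<Rightarrow> 'g"
  assumes "L \<noteq> {}"
    and "dynamical_group L G"
    and "constant_dynamical_group L H"
    and "dyn_group_action L G H \<Phi>"
    and "relative_rota_baxter L G H \<Phi> B"
    and lact_def: "\<And>l a x. \<lbrakk>l \<in> L; a \<in> carrier G; x \<in> carrier H\<rbrakk> \<Longrightarrow> lact l a x = \<Phi> l a x"
    and ract_def: "\<And>l a x. \<lbrakk>l \<in> L; a \<in> carrier G; x \<in> carrier H\<rbrakk> \<Longrightarrow>
      ract l a x =
        dmul G (phi G l (B (\<Phi> l a x))) (dinv G l (B (\<Phi> l a x))) (dmul G l a (B x))"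
  shows "matched_pair L G (descendant G H \<Phi> B) (\<lambda>l (a, x). (lact l a x, ract l a x))"
proof -
  interpret relative_rota_baxter L G H \<Phi> B by fact
  interpret D: dynamical_group L "descendant G H \<Phi> B" by (rule descendant_dynamical_group)
  have ract_eq: "ract l a x = rb_ract l a x" if "l \<in> L" "a \<in> carrier G" "x \<in> carrier H" for l a x
    using that by (simp add: ract_def rb_ract_def)
  \<comment> \<open>The given actions are prescribed only on \<open>L\<close> and the carriers, so
    each rewriting needs these membership facts.\<close>
  note closed = act_closed rb_closed rb_ract_closed desc_dmul_closed
    G.phi_closed G.dmul_closed G.dunit_closed H.dunit_closed
  show ?thesis
  proof unfold_locales
    show "dyn_morphism L (dyn_tensor G (descendant G H \<Phi> B)) (dyn_tensor (descendant G H \<Phi> B) G)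
        (\<lambda>l (a, x). (lact l a x, ract l a x))"
      by (auto simp: dyn_morphism_def dyn_tensor_def descendant_simps lact_def ract_eq closed
          phi_rb_ract)
  \<comment> \<open>Reversing \<open>act_dmul_left\<close> folds nested actions into one, the form
    of the parameter in \<open>rb_ract_dmul\<close>.\<close>
  qed (simp_all add: descendant_simps lact_def ract_eq closed act_dunit_left
      act_dmul_left[symmetric] act_desc_dmul_rb_ract rb_ract_dunit rb_ract_desc_dmul rb_ract_dmul)
qed

end
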